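(* Let $k \in \mathbb{N}$ and let $G_k=(V,E)$ be a $k$-regular graph with $|V| < +\infty$. Let $d>0$ and let $f:\mathbb{R}\to\mathbb{R}$ be continuous. Then for each stationary solution $u$ of $$\dot{u}_i(t) = d \sum_{j \in N(i)}(u_j(t)-u_i(t))+f(u_i(t)), \quad i \in V,\ t>0,$$ on $G_k$ there exist $n\in\mathbb{N}$ and a matrix $\mathbf{m} \in \mathbb{N}_{0}^{n \times n}$ such that $u$ is an $\mathbf{m}$-perfect stationary solution.
   Context: Graphs are undirected and simple; $N(i)=\{j\in V:\{i,j\}\in E\}$; $G_k$ is $k$-regular if $|N(i)|=k$ for all $i\in V$. A stationary solution is a map $u:V\to\mathbb{R}$ with $0=d\sum_{j\in N(i)}(u_j-u_i)+f(u_i)$ for all $i\in V$; $\mathrm{Im}(u)$ is its set of values. For $C=\{1,\dots,n\}$ and $\mathbf{m}\in\mathbb{N}_0^{n\times n}$ with all row sums equal to $k$, a coloring $\Gamma:V\to C$ is $\mathbf{m}$-perfect if for every $i\in V$ and every $c\in C$ the number of $j\in N(i)$ with $\Gamma(j)=c$ equals $m_{\Gamma(i)c}$. A stationary solution $u$ is an $\mathbf{m}$-perfect stationary solution (where $\mathbf{m}$ has all row sums equal to $k$) if there exist an $\mathbf{m}$-perfect coloring $\Gamma$ of $G_k$ and a surjection $v:C\to\mathrm{Im}(u)$ such that $v_{\Gamma(i)}=u_i$ for every $i\in V$. *)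

theory Defs
  imports Complex_Main "HOL-Library.FuncSet"
begin

(* Graphs are nonempty, as usual: on the empty graph there is no map from the
   nonempty color set {1..n} to the empty image of u. *)
definition simple_graph :: "'v set \<Rightarrow> 'v set set \<Rightarrow> bool" where
  "simple_graph V E \<longleftrightarrow> V \<noteq> {} \<and> (\<forall>e\<in>E. e \<subseteq> V \<and> card e = 2)"

definition nbhd :: "'v set \<Rightarrow> 'v set set \<Rightarrow> 'v \<Rightarrow> 'v set" where
  "nbhd V E i = {j\<in>V. {i, j} \<in> E}"

definition regular_graph :: "nat \<Rightarrow> 'v set \<Rightarrow> 'v set set \<Rightarrow> bool" where
  "regular_graph k V E \<longleftrightarrow>
     simple_graph V E \<and> (\<forall>i\<in>V. finite (nbhd V E i) \<and> card (nbhd V E i) = k)"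

(* A map on V is represented by a total function whose values outside V are never used. *)
definition stationary_solution ::
    "'v set \<Rightarrow> 'v set set \<Rightarrow> real \<Rightarrow> (real \<Rightarrow> real) \<Rightarrow> ('v \<Rightarrow> real) \<Rightarrow> bool" where
  "stationary_solution V E d f u \<longleftrightarrow>
     (\<forall>i\<in>V. 0 = d * (\<Sum>j\<in>nbhd V E i. u j - u i) + f (u i))"

(* An n-by-n matrix over the nonnegative integers is a function of two indices,
   of which only the values on {1..n} are used. *)
definition row_sums :: "nat \<Rightarrow> nat \<Rightarrow> (nat \<Rightarrow> nat \<Rightarrow> nat) \<Rightarrow> bool" where
  "row_sums k n m \<longleftrightarrow> (\<forall>a\<in>{1..n}. (\<Sum>c\<in>{1..n}. m a c) = k)"

definition perfect_coloring ::
    "'v set \<Rightarrow> 'v set set \<Rightarrow> nat \<Rightarrow> (nat \<Rightarrow> nat \<Rightarrow> nat) \<Rightarrow> ('v \<Rightarrow> nat) \<Rightarrow> bool" where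
  "perfect_coloring V E n m \<Gamma> \<longleftrightarrow>
     \<Gamma> \<in> V \<rightarrow> {1..n} \<and>
     (\<forall>i\<in>V. \<forall>c\<in>{1..n}. card {j \<in> nbhd V E i. \<Gamma> j = c} = m (\<Gamma> i) c)"

definition perfect_stationary_solution ::
    "nat \<Rightarrow> 'v set \<Rightarrow> 'v set set \<Rightarrow> real \<Rightarrow> (real \<Rightarrow> real) \<Rightarrow> nat \<Rightarrow> (nat \<Rightarrow> nat \<Rightarrow> nat)
      \<Rightarrow> ('v \<Rightarrow> real) \<Rightarrow> bool" where
  "perfect_stationary_solution k V E d f n m u \<longleftrightarrow>
     stationary_solution V E d f u \<and> row_sums k n m \<and>
     (\<exists>\<Gamma> v. perfect_coloring V E n m \<Gamma> \<and> v ` {1..n} = u ` V \<and> (\<forall>i\<in>V. v (\<Gamma> i) = u i))"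

end

theory Submission
  imports Defs
begin

text \<open>
  Give every vertex its own color. A condition that compares vertices of equal color is then
  vacuous, so this coloring is perfect, and its matrix is the adjacency matrix of the graph.
  Every function on the vertices, and in particular the stationary solution, is constant on
  the color classes, because these are singletons. The row sums of the matrix are the vertex
  degrees, hence equal to \<open>k\<close> by regularity.
\<close>

text \<open>Since every color occurs, each row of the matrix counts the neighbors of some vertex,
  sorted by color, and its sum is the degree of that vertex.\<close>

lemma perfect_coloring_row_sums:
  assumes "regular_graph k V E" and "perfect_coloring V E n m \<Gamma>" and "\<Gamma> ` V = {1..n}"
  shows "row_sums k n m"
  unfolding row_sums_def
proof
  fix a assume "a \<in> {1..n}"
  then have "a \<in> \<Gamma> ` V"
    by (simp only: assms(3))
  then obtain i where i: "i \<in> V" "\<Gamma> i = a"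
    by auto
  have fin: "finite (nbhd V E i)" and deg: "card (nbhd V E i) = k"
    using assms(1) i(1) by (auto simp: regular_graph_def)
  have colors: "\<Gamma> ` nbhd V E i \<subseteq> {1..n}"
    using assms(3) by (auto simp: nbhd_def)
  have "(\<Sum>c\<in>{1..n}. m a c) = (\<Sum>c\<in>{1..n}. card {j \<in> nbhd V E i. \<Gamma> j = c})"
    using assms(2) i by (intro sum.cong) (auto simp: perfect_coloring_def)
  also have "\<dots> = (\<Sum>c\<in>{1..n}. \<Sum>j\<in>{j \<in> nbhd V E i. \<Gamma> j = c}. 1)"
    by simp
  also have "\<dots> = (\<Sum>j\<in>nbhd V E i. 1)"
    using fin colors by (rule sum.group[OF _ finite_atLeastAtMost])
  finally show "(\<Sum>c\<in>{1..n}. m a c) = k"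
    using deg by simp
qed

text \<open>The color of a vertex determines the vertex, and so also its numbers of neighbors.\<close>

lemma bijective_coloring_perfect:
  assumes "bij_betw \<Gamma> V {1..n}"
  shows "perfect_coloring V E n
    (\<lambda>a c. card {j \<in> nbhd V E (inv_into V \<Gamma> a). \<Gamma> j = c}) \<Gamma>"
  using assms
  by (auto simp: perfect_coloring_def bij_betw_inv_into_left dest: bij_betw_apply)

theorem lemma3p7:
  fixes k :: nat and V :: "'v set" and E :: "'v set set"
    and d :: real and f :: "real \<Rightarrow> real" and u :: "'v \<Rightarrow> real"
  assumes "k \<ge> 1"
    and "regular_graph k V E"
    and "finite V"
    and "d > 0"
    and "continuous_on UNIV f"
    and "stationary_solution V E d f u"
  shows "\<exists>n m. n \<ge> 1 \<and> perfect_stationary_solution k V E d f n m u"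
proof -
  define n where "n = card V"
  have "card V = card {1..n}"
    by (simp add: n_def)
  then have "\<exists>\<Gamma>. bij_betw \<Gamma> V {1..n}"
    by (rule finite_same_card_bij[OF assms(3) finite_atLeastAtMost])
  then obtain \<Gamma> where \<Gamma>: "bij_betw \<Gamma> V {1..n}" ..
  obtain m where perfect: "perfect_coloring V E n m \<Gamma>"
    using bijective_coloring_perfect[OF \<Gamma>] ..
  define v where "v = u \<circ> inv_into V \<Gamma>"
  have "V \<noteq> {}"
    using assms(2) by (simp add: regular_graph_def simple_graph_def)
  then have n: "n \<ge> 1"
    using assms(3) by (simp add: n_def Suc_le_eq card_gt_0_iff)
  have "row_sums k n m"
    using perfect_coloring_row_sums[OF assms(2) perfect] \<Gamma> by (simp add: bij_betw_def)
  moreover have "v ` {1..n} = u ` V"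
    using bij_betw_imp_surj_on[OF bij_betw_inv_into[OF \<Gamma>]]
    by (simp only: v_def image_comp [symmetric])
  moreover have "\<forall>i\<in>V. v (\<Gamma> i) = u i"
    using \<Gamma> by (simp add: v_def bij_betw_inv_into_left)
  ultimately have "perfect_stationary_solution k V E d f n m u"
    unfolding perfect_stationary_solution_def using assms(6) perfect
    by (intro conjI exI[of _ \<Gamma>] exI[of _ v])
  with n show ?thesis
    by (intro exI conjI)
qed

end
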